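(* Let $x$ be an indeterminate. For integers $p\ge r\ge 0$ let $$k_{r,p}(x) = (-1)^{p-r}\binom{x+p}{p-r}\binom{2r}{r}\binom{p+r}{r}^{-1}.$$ Then for all integers $p,q\geq 0$, $$(-1)^{p+q}\binom{x+p+q}{p+q} = k_{0,p}(x)k_{0,q}(x) + \sum_{i=1}^{\max(p,q)}\lambda_{i+1}(x)\,k_{i,p}(x)\,k_{i,q}(x).$$
   Context: $\binom{y}{k} = y(y-1)\cdots(y-k+1)/k!$ for integers $k\ge 0$ and $\binom{y}{k}=0$ for integers $k<0$; accordingly $k_{r,p}(x)=0$ when $r>p$. For integers $h\ge 2$, $$\lambda_h(x) := \prod_{i=2}^{h}\mathrm{ab}_{x,i},\qquad \mathrm{ab}_{x,2} := -\tfrac12 x(x+1),\qquad \mathrm{ab}_{x,i} := -\frac{1}{4(2i-3)^2}(x-i+2)(x+i-1)\ \ (i\ge 3),$$ equivalently $$\lambda_h(x) = \frac{(-1)^{h-1}}{2}\binom{x+h-1}{h-1}\binom{x}{h-1}\binom{2h-3}{h-2}^{-2}.$$ *)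

theory Defs
  imports Complex_Main "HOL-Computational_Algebra.Polynomial"
begin

definition X :: "rat poly" where
  "X = [:0, 1:]"

text \<open>
  The library's \<open>gchoose\<close> is constrained to fields of characteristic 0, so it does not apply to
  \<open>rat poly\<close>; the lemma below says that the two agree at every value of the indeterminate.
\<close>
definition zbinom :: "rat poly \<Rightarrow> int \<Rightarrow> rat poly" where
  "zbinom y k = (if k < 0 then 0 else smult (1 / fact (nat k)) (\<Prod>i<nat k. y - of_nat i))"

lemma poly_zbinom: "poly (zbinom y (int k)) a = poly y a gchoose k"
  by (simp add: zbinom_def poly_prod gbinomial_prod_rev lessThan_atLeast0)

definition k_poly :: "nat \<Rightarrow> nat \<Rightarrow> rat poly" where
  "k_poly r p =
     smult ((-1) powi (int p - int r) * of_nat ((2 * r) choose r) * inverse (of_nat ((p + r) choose r)))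
       (zbinom (X + of_nat p) (int p - int r))"

text \<open>Only the values at \<open>i \<ge> 2\<close> are meaningful.\<close>
definition ab_poly :: "nat \<Rightarrow> rat poly" where
  "ab_poly i =
     (if i = 2 then smult (- (1 / 2)) (X * (X + 1))
      else smult (- (1 / (4 * (2 * of_nat i - 3)\<^sup>2))) ((X - of_nat i + 2) * (X + of_nat i - 1)))"

definition lambda_poly :: "nat \<Rightarrow> rat poly" where
  "lambda_poly h = (\<Prod>i = 2..h. ab_poly i)"

end

theory Submission
  imports Defs
begin

text \<open>
  Both sides are polynomials in \<open>x\<close>, so it suffices to compare their values at infinitely many
  points, and \<open>x \<ge> 0\<close> is convenient because no \<open>x + n + 1\<close> vanishes there.  After
  inserting the closed form of \<open>\<lambda>\<close> (lemma \<open>poly_lambda_poly\<close>), the factor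
  \<open>(x + 1) \<cdots> (x + i)\<close> of \<open>\<lambda>\<close> and the factor \<open>(x + i + 1) \<cdots> (x + p)\<close> of
  \<open>k\<^sub>i\<^sub>,\<^sub>p\<close> merge into a product that does not depend on \<open>i\<close>.  Up to such constants, the term
  with index \<open>i\<close> is then twice
  \[ t_p(i) = (-1)^i \binom{2p}{p+i} \binom{2q}{q+i}
       \frac{\Gamma(x+1)\,\Gamma(x+q+1)}{\Gamma(x-i+1)\,\Gamma(x+i+1)} \]
  (lemma \<open>poly_term_eq_summand\<close>).  This is even in \<open>i\<close>, and the term outside the sum is
  \<open>t_p(0)\<close> up to the same constant, so the right-hand side is the sum of \<open>t_p\<close> over all integers.

  This bilateral sum is evaluated by induction on \<open>p\<close> (lemma \<open>symmetric_sum_closed_form\<close>).  The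
  recurrence from \<open>p\<close> to \<open>P = p + 1\<close> (lemma \<open>symmetric_sum_recurrence\<close>) is found by
  telescoping: a suitable combination of \<open>t_P(i)\<close> and \<open>t_p(i)\<close> equals
  \<open>(P q x + i\<^sup>2 (P + q + x)) t_P(i)\<close>, whose first factor is the even part of
  \<open>(P + i) (q + i) (x + i)\<close>.  Since the ratio of consecutive terms of \<open>t_P\<close> is
  \<open>- (P - i) (q - i) (x - i) / ((P + i + 1) (q + i + 1) (x + i + 1))\<close>, twice that combination is
  \<open>u(i) - u(i + 1)\<close> for \<open>u(i) = (P + i) (q + i) (x + i) t_P(i)\<close>.
\<close>

section \<open>Recurrences for binomial coefficients around the centre\<close>

text \<open>
  The differences are taken in the ring, not in \<open>nat\<close>: this and the next identity then hold
  without bounds on \<open>i\<close>, so that the summation needs no case distinction between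
  \<open>i \<le> p\<close> and \<open>i > p\<close>.
\<close>
lemma central_binomial_step:
  "(of_nat n + of_nat i + 1) * of_nat ((2 * n) choose (n + i + 1))
     = (of_nat n - of_nat i :: 'a :: comm_ring_1) * of_nat ((2 * n) choose (n + i))"
proof (cases "i \<le> n")
  case True
  have "Suc (n + i) * ((2 * n) choose Suc (n + i)) = (n - i) * ((2 * n) choose (n + i))"
    using binomial_absorption[of "n + i" "2 * n"] binomial_absorb_comp[of "2 * n" "n + i"]
    by simp
  then have "of_nat (Suc (n + i) * ((2 * n) choose Suc (n + i)))
      = (of_nat ((n - i) * ((2 * n) choose (n + i))) :: 'a)"
    by (rule arg_cong)
  then show ?thesis
    using True by (simp add: of_nat_diff algebra_simps)
qed (simp add: binomial_eq_0)

lemma central_binomial_Suc: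
  "(of_nat (Suc n) + of_nat i) * (of_nat (Suc n) - of_nat i) * of_nat ((2 * Suc n) choose (Suc n + i))
     = of_nat (2 * Suc n) * of_nat (2 * n + 1) * (of_nat ((2 * n) choose (n + i)) :: 'a :: comm_ring_1)"
proof (cases "i \<le> Suc n")
  case True
  have down: "(Suc n + i) * ((2 * Suc n) choose (Suc n + i)) = (2 * Suc n) * ((2 * n + 1) choose (n + i))"
    using binomial_absorption[of "n + i" "2 * Suc n"] by simp
  have up: "(Suc n - i) * ((2 * n + 1) choose (n + i)) = (2 * n + 1) * ((2 * n) choose (n + i))"
    using binomial_absorb_comp[of "2 * n + 1" "n + i"] by simp
  have "(Suc n + i) * (Suc n - i) * ((2 * Suc n) choose (Suc n + i))
      = (Suc n - i) * ((Suc n + i) * ((2 * Suc n) choose (Suc n + i)))"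
    by (simp only: mult_ac)
  also have "\<dots> = (2 * Suc n) * ((Suc n - i) * ((2 * n + 1) choose (n + i)))"
    unfolding down by (simp only: mult_ac)
  also have "\<dots> = (2 * Suc n) * (2 * n + 1) * ((2 * n) choose (n + i))"
    unfolding up by (simp only: mult_ac)
  finally have "(Suc n + i) * (Suc n - i) * ((2 * Suc n) choose (Suc n + i))
      = (2 * Suc n) * (2 * n + 1) * ((2 * n) choose (n + i))" .
  then have "of_nat ((Suc n + i) * (Suc n - i) * ((2 * Suc n) choose (Suc n + i)))
      = (of_nat ((2 * Suc n) * (2 * n + 1) * ((2 * n) choose (n + i))) :: 'a)"
    by (rule arg_cong)
  then show ?thesis
    using True by (simp only: of_nat_mult of_nat_add of_nat_diff)
qed (simp add: binomial_eq_0)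

section \<open>The summation\<close>

text \<open>
  The two Pochhammer symbols are the Gamma quotient
  \<open>\<Gamma>(x+1) \<Gamma>(x+q+1) / (\<Gamma>(x-i+1) \<Gamma>(x+i+1))\<close>, written as a polynomial in \<open>x\<close>.
  They have this meaning only for \<open>i \<le> q\<close>; beyond that the second binomial coefficient is zero.
\<close>
definition summand :: "nat \<Rightarrow> 'a :: field_char_0 \<Rightarrow> nat \<Rightarrow> nat \<Rightarrow> 'a" where
  "summand q x p i = (-1) ^ i * of_nat ((2 * p) choose (p + i)) * of_nat ((2 * q) choose (q + i))
     * (pochhammer (x - of_nat i + 1) i * pochhammer (x + of_nat i + 1) (q - i))"

text \<open>
  The summand is hypergeometric in \<open>i\<close> with a ratio symmetric in \<open>p\<close>, \<open>q\<close> and \<open>x\<close>: the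
  Gamma quotient contributes the factor for \<open>x\<close> in the same shape as the binomial coefficients
  contribute those for \<open>p\<close> and \<open>q\<close>.
\<close>
lemma summand_step:
  assumes "i \<le> q"
  shows "(of_nat p + of_nat i + 1) * (of_nat q + of_nat i + 1) * (x + of_nat i + 1) * summand q x p (i + 1)
    = - ((of_nat p - of_nat i) * (of_nat q - of_nat i) * (x - of_nat i) * summand q x p i)"
proof (cases "i = q")
  case True
  then show ?thesis by (simp add: summand_def binomial_eq_0)
next
  case False
  then obtain d where d: "q = Suc (i + d)"
    using assms less_imp_Suc_add by (metis le_neq_implies_less)
  define P where "P j = pochhammer (x - of_nat j + 1) j * pochhammer (x + of_nat j + 1) (q - j)" for j
  have G: "(x + of_nat i + 1) * P (i + 1) = (x - of_nat i) * P i"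
    by (simp add: P_def d Suc_diff_le pochhammer_rec add_ac)
  have "(of_nat p + of_nat i + 1) * (of_nat q + of_nat i + 1) * (x + of_nat i + 1) * summand q x p (i + 1)
    = - ((-1) ^ i) * ((of_nat p + of_nat i + 1) * of_nat ((2 * p) choose (p + i + 1)))
       * ((of_nat q + of_nat i + 1) * of_nat ((2 * q) choose (q + i + 1)))
       * ((x + of_nat i + 1) * P (i + 1))"
    by (simp add: summand_def P_def mult_ac)
  also have "\<dots> = - ((of_nat p - of_nat i) * (of_nat q - of_nat i) * (x - of_nat i) * summand q x p i)"
    unfolding G central_binomial_step by (simp add: summand_def P_def mult_ac)
  finally show ?thesis .
qed

text \<open>
  The recurrence compares with the expected closed form, whose value at \<open>Suc p\<close> is a rational
  multiple of its value at \<open>p\<close>.  Writing \<open>r\<close> for \<open>p + 1\<close>, the difference of the two sides,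
  multiplied by \<open>r\<close>, telescopes with certificate \<open>u\<close>.  Since the sum is folded at \<open>i = 0\<close>,
  the telescoping leaves the boundary term \<open>u 1\<close>, which cancels the unfolded term \<open>D 0\<close>.
\<close>
lemma symmetric_sum_recurrence:
  fixes x :: "'a :: field_char_0" and q :: nat
  defines "S \<equiv> (\<lambda>p. summand q x p 0 + 2 * (\<Sum>i = 1..q. summand q x p i))"
  shows "(x + of_nat p + 1) * (of_nat p + 1 + of_nat q) * S (Suc p)
    = 2 * of_nat (2 * p + 1) * (x + of_nat p + 1 + of_nat q) * S p"
proof -
  define r :: 'a where "r = of_nat (Suc p)"
  define s where "s = summand q x (Suc p)"
  define u where "u i = (r + of_nat i) * (of_nat q + of_nat i) * (x + of_nat i) * s i" for i
  define D where "D i = r * (x + r) * (r + of_nat q) * s i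
      - 2 * r * of_nat (2 * p + 1) * (x + r + of_nat q) * summand q x p i" for i
  have u_Suc: "u (Suc i) = - ((r - of_nat i) * (of_nat q - of_nat i) * (x - of_nat i) * s i)" if "i \<le> q" for i
    using summand_step[OF that, of "Suc p" x] by (simp add: u_def s_def r_def add_ac)
  have p_to_Suc_p: "2 * r * of_nat (2 * p + 1) * summand q x p i = (r + of_nat i) * (r - of_nat i) * s i" for i
    using central_binomial_Suc[of p i, where ?'a = 'a]
    unfolding summand_def s_def r_def by (simp only: mult_ac of_nat_mult of_nat_numeral)
  have D_eq: "D i = (r * of_nat q * x + (of_nat i)\<^sup>2 * (x + r + of_nat q)) * s i" for i
  proof -
    have "D i = r * (x + r) * (r + of_nat q) * s i
        - (x + r + of_nat q) * (2 * r * of_nat (2 * p + 1) * summand q x p i)"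
      by (simp add: D_def mult_ac)
    then show ?thesis
      unfolding p_to_Suc_p by (simp add: algebra_simps power2_eq_square)
  qed
  \<comment> \<open>The odd parts of \<open>(r + i) (q + i) (x + i)\<close> cancel, and twice the even part is left.\<close>
  have tele: "2 * D i = u i - u (Suc i)" if "i \<le> q" for i
    unfolding u_Suc[OF that] D_eq unfolding u_def by (simp add: algebra_simps power2_eq_square)
  have "D 0 + 2 * (\<Sum>i = 1..q. D i) = D 0 + (\<Sum>i = 1..q. u i - u (Suc i))"
    by (simp add: sum_distrib_left tele)
  also have "(\<Sum>i = 1..q. u i - u (Suc i)) = u 1 - u (Suc q)"
    using sum_Suc_diff[of 1 q "\<lambda>i. - u i"] by simp
  also have "u (Suc q) = 0"
    by (simp add: u_Suc)
  also have "D 0 + (u 1 - 0) = 0"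
    using u_Suc[of 0] by (simp add: D_eq)
  finally have zero: "D 0 + 2 * (\<Sum>i = 1..q. D i) = 0" .
  define A B where "A = (\<Sum>i = 1..q. s i)" and "B = (\<Sum>i = 1..q. summand q x p i)"
  have sum_D: "(\<Sum>i = 1..q. D i) = r * (x + r) * (r + of_nat q) * A
      - 2 * r * of_nat (2 * p + 1) * (x + r + of_nat q) * B"
    unfolding A_def B_def by (simp only: D_def sum_subtractf sum_distrib_left)
  have S: "S (Suc p) = s 0 + 2 * A" "S p = summand q x p 0 + 2 * B"
    by (simp_all add: S_def s_def A_def B_def)
  have "r * ((x + r) * (r + of_nat q) * S (Suc p)
      - 2 * of_nat (2 * p + 1) * (x + r + of_nat q) * S p)
      = D 0 + 2 * (\<Sum>i = 1..q. D i)"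
    unfolding sum_D S unfolding D_def by (simp add: algebra_simps)
  also note zero
  finally have "(x + r) * (r + of_nat q) * S (Suc p)
      = 2 * of_nat (2 * p + 1) * (x + r + of_nat q) * S p"
    by (simp add: r_def del: of_nat_Suc)
  moreover have "r = of_nat p + 1"
    by (simp add: r_def)
  ultimately show ?thesis
    by (simp only: add.assoc)
qed

text \<open>
  The recurrence determines the sum at \<open>Suc p\<close> only where \<open>x + p + 1\<close> is nonzero, hence the
  assumption.
\<close>
lemma symmetric_sum_closed_form:
  fixes x :: "'a :: field_char_0"
  assumes x: "\<And>n. x + of_nat n + 1 \<noteq> 0"
  shows "summand q x p 0 + 2 * (\<Sum>i = 1..q. summand q x p i)
    = fact (2 * p) * fact (2 * q) / (fact p * fact q * fact (p + q)) * pochhammer (x + of_nat p + 1) q"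
    (is "?S p = ?R p")
proof (induction p)
  case 0
  have "(\<Sum>i = 1..q. summand q x 0 i) = 0"
    by (intro sum.neutral) (simp add: summand_def binomial_eq_0)
  then show ?case
    by (simp add: summand_def binomial_fact add_ac mult_2)
next
  case (Suc p)
  define a where "a = of_nat p + (1 :: 'a)"
  have a0: "a \<noteq> 0" "a + of_nat q \<noteq> 0"
    using of_nat_neq_0[of p, where ?'a = 'a] of_nat_neq_0[of "p + q", where ?'a = 'a]
    by (simp_all add: a_def add_ac)
  have poch: "(x + a) * pochhammer (x + a + 1) q = (x + a + of_nat q) * pochhammer (x + a) q"
    using pochhammer_rec[of "x + a" q] pochhammer_rec'[of "x + a" q] by simp
  have f1: "fact (2 * Suc p) = 2 * a * of_nat (2 * p + 1) * (fact (2 * p) :: 'a)"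
    by (simp add: a_def algebra_simps)
  have f2: "fact (Suc p) = a * (fact p :: 'a)"
    by (simp add: a_def algebra_simps)
  have f3: "fact (Suc p + q) = (a + of_nat q) * (fact (p + q) :: 'a)"
    by (simp add: a_def algebra_simps)
  have "(x + a) * (a + of_nat q) * ?R (Suc p)
      = (x + a) * (a + of_nat q) * (2 * a * of_nat (2 * p + 1) * fact (2 * p) * fact (2 * q)
          / (a * fact p * fact q * ((a + of_nat q) * fact (p + q))) * pochhammer (x + a + 1) q)"
    unfolding f1 f2 f3 by (simp add: a_def add_ac)
  also have "\<dots> = 2 * of_nat (2 * p + 1) * (fact (2 * p) * fact (2 * q) / (fact p * fact q * fact (p + q)))
      * ((x + a) * pochhammer (x + a + 1) q)"
    using a0 by (simp add: divide_simps)
  also have "\<dots> = 2 * of_nat (2 * p + 1) * (x + a + of_nat q) * ?R p"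
    unfolding poch by (simp add: a_def add_ac)
  also have "\<dots> = (x + a) * (a + of_nat q) * ?S (Suc p)"
    using symmetric_sum_recurrence[of x p q] Suc by (simp add: a_def add_ac)
  finally have eq: "(x + a) * (a + of_nat q) * ?R (Suc p) = (x + a) * (a + of_nat q) * ?S (Suc p)" .
  have nz: "(x + a) * (a + of_nat q) \<noteq> 0"
    using a0 x[of p] by (simp add: a_def add_ac)
  show ?case
    using eq unfolding mult_left_cancel[OF nz] by (rule sym)
qed

section \<open>Evaluating the polynomials\<close>

text \<open>
  Pochhammer symbols with the common starting point \<open>a + i + 1\<close> make the products of the
  binomial factors visible as concatenations.
\<close>
lemma gbinomial_shift_pochhammer:
  fixes a :: "'a :: field_char_0"
  assumes "i \<le> p"
  shows "(a + of_nat p) gchoose (p - i) = pochhammer (a + of_nat i + 1) (p - i) / fact (p - i)"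
  using assms by (simp add: gbinomial_pochhammer' of_nat_diff add_ac)

lemma poly_k_poly:
  assumes "i \<le> p"
  shows "poly (k_poly i p) a = (-1) ^ (p - i) * (fact (2 * i) * fact p / (fact i * fact (p + i) * fact (p - i)))
    * pochhammer (a + of_nat i + 1) (p - i)"
proof -
  have pi: "int p - int i = int (p - i)"
    using assms by simp
  have "inverse (of_nat ((p + i) choose i)) * of_nat ((2 * i) choose i)
      = (fact (2 * i) * fact p / (fact i * fact (p + i)) :: rat)"
    by (simp add: binomial_fact[where ?'a = rat] mult_2 mult_ac)
  then show ?thesis
    unfolding k_poly_def pi
    by (simp add: poly_zbinom X_def power_int_of_nat gbinomial_shift_pochhammer[OF assms])
      (simp add: field_simps)
qed

lemma k_poly_eq_0: "p < i \<Longrightarrow> k_poly i p = 0"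
  by (simp add: k_poly_def zbinom_def)

text \<open>
  At \<open>i = 0\<close> the left-hand side is \<open>1\<close> and the right-hand side is \<open>2\<close>: the factor
  \<open>ab_poly 2\<close> is twice what the general formula would give.  This factor \<open>2\<close> is the one by which
  the positive indices stand for both signs in the bilateral sum.
\<close>
lemma poly_lambda_poly:
  assumes "1 \<le> i"
  shows "poly (lambda_poly (i + 1)) a
    = 2 * (-1) ^ i * pochhammer (a + 1) i * pochhammer (a - of_nat i + 1) i * (fact i / fact (2 * i))\<^sup>2"
  using assms
proof (induction i rule: nat_induct_at_least)
  case base
  then show ?case
    by (simp add: lambda_poly_def ab_poly_def X_def numeral_2_eq_2 power2_eq_square algebra_simps)
next
  case (Suc i)
  have ab: "poly (ab_poly (Suc i + 1)) a
      = - ((a - of_nat i) * (a + of_nat i + 1) / (4 * (2 * of_nat i + 1)\<^sup>2))"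
    using Suc.hyps by (simp add: ab_poly_def X_def algebra_simps)
  have lam: "lambda_poly (Suc i + 1) = lambda_poly (i + 1) * ab_poly (Suc i + 1)"
    unfolding lambda_poly_def using Suc.hyps by (simp add: prod.nat_ivl_Suc')
  have p1: "pochhammer (a + 1) (Suc i) = (a + of_nat i + 1) * pochhammer (a + 1) i"
    by (simp add: pochhammer_rec' add_ac)
  have p2: "pochhammer (a - of_nat (Suc i) + 1) (Suc i) = (a - of_nat i) * pochhammer (a - of_nat i + 1) i"
    by (simp add: pochhammer_rec)
  have "fact (Suc i) / fact (2 * Suc i) = (of_nat (Suc i) * fact i)
      / (of_nat (Suc i) * (2 * (2 * of_nat i + 1) * (fact (2 * i) :: rat)))"
    by (simp add: algebra_simps)
  also have "\<dots> = fact i / fact (2 * i) / (2 * (2 * of_nat i + 1))"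
    by (subst mult_divide_mult_cancel_left) (simp_all add: mult_ac del: of_nat_Suc)
  finally have f0: "fact (Suc i) / fact (2 * Suc i)
      = fact i / fact (2 * i) / (2 * (2 * of_nat i + 1) :: rat)" .
  have f: "(fact (Suc i) / fact (2 * Suc i))\<^sup>2
      = (fact i / fact (2 * i) :: rat)\<^sup>2 / (4 * (2 * of_nat i + 1)\<^sup>2)"
    unfolding f0 by (simp only: power_divide power_mult_distrib) simp
  show ?case
    unfolding lam poly_mult Suc.IH ab p1 p2 f by simp
qed

text \<open>
  The factor in front of the summand is independent of \<open>i\<close> because
  \<open>(a + 1) \<cdots> (a + i)\<close>, from \<open>lambda_poly\<close>, and \<open>(a + i + 1) \<cdots> (a + p)\<close>, from
  \<open>k_poly i p\<close>, concatenate.  Treating \<open>p\<close> and \<open>q\<close> asymmetrically here is what leaves a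
  Gamma quotient involving \<open>q\<close> alone, so that the induction on \<open>p\<close> is possible.
\<close>
lemma poly_term_eq_summand:
  assumes "1 \<le> i" "i \<le> q"
  shows "poly (lambda_poly (i + 1) * k_poly i p * k_poly i q) a
    = (-1) ^ (p + q) * pochhammer (a + 1) p * (fact p * fact q / (fact (2 * p) * fact (2 * q)))
        * (2 * summand q a p i)"
proof (cases "i \<le> p")
  case False
  then show ?thesis
    by (simp add: k_poly_eq_0 summand_def binomial_eq_0)
next
  case True
  have poch: "pochhammer (a + 1) p = pochhammer (a + 1) i * pochhammer (a + of_nat i + 1) (p - i)"
    using pochhammer_product[OF True, of "a + 1"] by (simp add: add_ac)
  have binom: "of_nat ((2 * n) choose (n + i)) = (fact (2 * n) / (fact (n + i) * fact (n - i)) :: rat)"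
    if "i \<le> n" for n
    using that binomial_fact[of "n + i" "2 * n", where ?'a = rat] by (simp add: mult_2)
  have sign: "(-1) ^ (p + q) = ((-1) ^ (p - i) * (-1) ^ (q - i) :: rat)"
    using True assms(2) by (auto simp add: minus_one_power_iff)
  show ?thesis
    unfolding poly_mult poly_lambda_poly[OF assms(1)] poly_k_poly[OF True] poly_k_poly[OF assms(2)]
      summand_def binom[OF True] binom[OF assms(2)] poch sign
    by (simp add: power2_eq_square mult_ac)
qed

theorem corollary2p7:
  fixes p q :: nat
  shows "(-1) ^ (p + q) * zbinom (X + of_nat p + of_nat q) (int p + int q) =
    k_poly 0 p * k_poly 0 q +
    (\<Sum>i = 1..max p q. lambda_poly (i + 1) * k_poly i p * k_poly i q)"
    (is "?L = ?R")
proof (rule ccontr)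
  let ?term = "\<lambda>i. lambda_poly (i + 1) * k_poly i p * k_poly i q"
  \<comment> \<open>The closed form sums up to \<open>q\<close>, the range in which the summand is meaningful.\<close>
  have cut: "(\<Sum>i = 1..max p q. ?term i) = (\<Sum>i = 1..q. ?term i)"
    by (rule sum.mono_neutral_right) (auto simp: k_poly_eq_0)
  have agree: "poly ?L a = poly ?R a" if "a \<ge> 0" for a
  proof -
    define c where "c = (-1) ^ (p + q) * pochhammer (a + 1) p
      * (fact p * fact q / (fact (2 * p) * fact (2 * q)))"
    have "a + of_nat n + 1 \<noteq> 0" for n
      using add_nonneg_nonneg[OF that of_nat_0_le_iff[of n]] by linarith
    note closed = symmetric_sum_closed_form[of a, OF this]
    have first: "poly (k_poly 0 p * k_poly 0 q) a = c * summand q a p 0"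
      by (simp add: poly_k_poly summand_def c_def binomial_fact[where ?'a = rat] mult_2 power_add)
    have "poly ?R a = c * summand q a p 0 + (\<Sum>i = 1..q. c * (2 * summand q a p i))"
      unfolding cut poly_add poly_sum first
      by (intro arg_cong2[where f = "(+)"] refl sum.cong) (simp only: poly_term_eq_summand c_def atLeastAtMost_iff)
    also have "\<dots> = c * (summand q a p 0 + 2 * (\<Sum>i = 1..q. summand q a p i))"
      by (simp add: sum_distrib_left distrib_left)
    also have "\<dots> = (-1) ^ (p + q) * pochhammer (a + 1) (p + q) / fact (p + q)"
      unfolding closed c_def by (simp add: pochhammer_product' add_ac)
    also have "\<dots> = poly ?L a"
      using poly_zbinom[of "X + of_nat p + of_nat q" "p + q" a] gbinomial_shift_pochhammer[of 0 "p + q" a]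
      by (simp add: X_def poly_power add_ac)
    finally show ?thesis ..
  qed
  assume "?L \<noteq> ?R"
  then have "finite {a. poly (?L - ?R) a = 0}"
    by (intro poly_roots_finite) simp
  moreover have "{0..} \<subseteq> {a. poly (?L - ?R) a = 0}"
    using agree by auto
  ultimately have "finite {(0 :: rat)..}"
    by (rule rev_finite_subset)
  then show False
    by (simp add: infinite_Ici)
qed

end
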